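(* Let $G$ be a compact Hausdorff topological group, and let $X$ be a distributive binary $G$-space (with $X$ Hausdorff). Then the orbit space $X|G$ is compact if and only if $X$ is compact, and $X|G$ is locally compact if and only if $X$ is locally compact.
   Context: A binary action of a topological group $G$ on a topological space $X$ is a continuous map $\alpha : G\times X^2\to X$, written $g(x,x')=\alpha(g,x,x')$, such that $gh(x,x')=g(x,h(x,x'))$ and $e(x,x')=x'$ for all $g,h\in G$, $x,x'\in X$, where $e$ is the identity of $G$ and $gh(x,x')$ means $(gh)(x,x')$. A space $X$ with a fixed binary action of $G$ is called a binary $G$-space. A binary $G$-space is distributive if $g(h(x,x'),h(x,x''))=h(x,g(x',x''))$ for all $x,x',x''\in X$ and $g,h\in G$. A subset $A\subset X$ is bi-invariant if $\{g(a,b) : g\in G,\ a,b\in A\}=A$. The orbit $[x]$ of $x\in X$ is the minimal bi-invariant subset of $X$ containing $x$. In a distributive binary $G$-space, $[x]=G(x,x)=\{g(x,x): g\in G\}$, and the orbits partition $X$. The orbit space $X|G$ is the set of orbits with the quotient topology induced by the map $X\to X|G$ taking each point to its orbit. A space is locally compact if every point has an open neighborhood with compact closure. *)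

theory Defs
  imports "HOL-Algebra.Group" "HOL-Analysis.Analysis"
begin

locale topological_group = group G for G (structure) +
  fixes T :: "'a topology"
  assumes topspace_eq_carrier: "topspace T = carrier G"
    and continuous_mult: "continuous_map (prod_topology T T) T (\<lambda>(g, h). g \<otimes> h)"
    and continuous_inv: "continuous_map T T (\<lambda>g. inv g)"

locale binary_G_space = topological_group G T for G (structure) and T +
  fixes X :: "'b topology"
    and act :: "'a \<Rightarrow> 'b \<Rightarrow> 'b \<Rightarrow> 'b"
  assumes continuous_act:
      "continuous_map (prod_topology T (prod_topology X X)) X (\<lambda>(g, x, x'). act g x x')"
    and act_mult: "\<lbrakk>g \<in> carrier G; h \<in> carrier G; x \<in> topspace X; x' \<in> topspace X\<rbrakk>
      \<Longrightarrow> act (g \<otimes> h) x x' = act g x (act h x x')"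
    and act_one: "\<lbrakk>x \<in> topspace X; x' \<in> topspace X\<rbrakk> \<Longrightarrow> act \<one> x x' = x'"

locale distributive_binary_G_space = binary_G_space +
  assumes distributive:
    "\<lbrakk>g \<in> carrier G; h \<in> carrier G; x \<in> topspace X; x' \<in> topspace X; x'' \<in> topspace X\<rbrakk>
      \<Longrightarrow> act g (act h x x') (act h x x'') = act h x (act g x' x'')"

definition bi_invariant ::
    "('g, 'm) monoid_scheme \<Rightarrow> 'x topology \<Rightarrow> ('g \<Rightarrow> 'x \<Rightarrow> 'x \<Rightarrow> 'x) \<Rightarrow> 'x set \<Rightarrow> bool"
  where "bi_invariant G X act A \<longleftrightarrow>
    A \<subseteq> topspace X \<and> {act g a b |g a b. g \<in> carrier G \<and> a \<in> A \<and> b \<in> A} = A"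

text \<open>The hull is the intersection of all bi-invariant sets containing the point; in a binary
  \<open>G\<close>-space it is itself bi-invariant, hence the least such set (see below).\<close>

definition bi_orbit ::
    "('g, 'm) monoid_scheme \<Rightarrow> 'x topology \<Rightarrow> ('g \<Rightarrow> 'x \<Rightarrow> 'x \<Rightarrow> 'x) \<Rightarrow> 'x \<Rightarrow> 'x set"
  where "bi_orbit G X act x = bi_invariant G X act hull {x}"

definition orbit_space ::
    "('g, 'm) monoid_scheme \<Rightarrow> 'x topology \<Rightarrow> ('g \<Rightarrow> 'x \<Rightarrow> 'x \<Rightarrow> 'x) \<Rightarrow> 'x set topology"
  where "orbit_space G X act = topology (\<lambda>U.
    U \<subseteq> bi_orbit G X act ` topspace X \<and> openin X {x \<in> topspace X. bi_orbit G X act x \<in> U})"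

text \<open>The library's \<^const>\<open>locally_compact_space\<close> only asks for an open neighbourhood contained in
  a compact set, which differs from the following notion outside Hausdorff spaces.\<close>

definition locally_compact_closure_space :: "'x topology \<Rightarrow> bool"
  where "locally_compact_closure_space X \<longleftrightarrow>
    (\<forall>x \<in> topspace X. \<exists>U. openin X U \<and> x \<in> U \<and> compactin X (X closure_of U))"

context binary_G_space
begin

lemma act_closed:
  assumes "g \<in> carrier G" "x \<in> topspace X" "y \<in> topspace X"
  shows "act g x y \<in> topspace X"
  using continuous_map_image_subset_topspace[OF continuous_act] assms topspace_eq_carrier
  by (force simp: image_subset_iff)

lemma bi_invariant_iff_closed:
  "bi_invariant G X act A \<longleftrightarrow>
    A \<subseteq> topspace X \<and> (\<forall>g \<in> carrier G. \<forall>a \<in> A. \<forall>b \<in> A. act g a b \<in> A)"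
proof
  assume "A \<subseteq> topspace X \<and> (\<forall>g \<in> carrier G. \<forall>a \<in> A. \<forall>b \<in> A. act g a b \<in> A)"
  moreover have "\<exists>g a b. x = act g a b \<and> g \<in> carrier G \<and> a \<in> A \<and> b \<in> A"
    if "x \<in> A" "A \<subseteq> topspace X" for x
    using that act_one[of x x] one_closed by (metis subsetD)
  ultimately show "bi_invariant G X act A"
    unfolding bi_invariant_def by blast
qed (unfold bi_invariant_def, blast)

lemma bi_invariant_topspace: "bi_invariant G X act (topspace X)"
  by (simp add: bi_invariant_iff_closed act_closed)

lemma bi_invariant_bi_orbit:
  assumes "x \<in> topspace X"
  shows "bi_invariant G X act (bi_orbit G X act x)"
proof -
  have "bi_orbit G X act x \<subseteq> topspace X"
    unfolding bi_orbit_def by (intro hull_minimal) (use assms bi_invariant_topspace in auto)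
  then show ?thesis
    by (auto simp: bi_invariant_iff_closed bi_orbit_def hull_def)
qed

lemma bi_orbit_refl: "x \<in> bi_orbit G X act x"
  by (auto simp: bi_orbit_def hull_def)

lemma bi_orbit_minimal:
  "\<lbrakk>bi_invariant G X act A; x \<in> A\<rbrakk> \<Longrightarrow> bi_orbit G X act x \<subseteq> A"
  by (auto simp: bi_orbit_def hull_def)

end

lemma openin_orbit_space:
  "openin (orbit_space G X act) U \<longleftrightarrow>
    U \<subseteq> bi_orbit G X act ` topspace X \<and> openin X {x \<in> topspace X. bi_orbit G X act x \<in> U}"
proof -
  let ?q = "bi_orbit G X act"
  have "istopology (\<lambda>U. U \<subseteq> ?q ` topspace X \<and> openin X {x \<in> topspace X. ?q x \<in> U})"
    unfolding istopology_def
  proof (intro conjI allI impI)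
    fix S U
    assume "S \<subseteq> ?q ` topspace X \<and> openin X {x \<in> topspace X. ?q x \<in> S}"
      and "U \<subseteq> ?q ` topspace X \<and> openin X {x \<in> topspace X. ?q x \<in> U}"
    moreover have "{x \<in> topspace X. ?q x \<in> S \<inter> U}
        = {x \<in> topspace X. ?q x \<in> S} \<inter> {x \<in> topspace X. ?q x \<in> U}"
      by auto
    ultimately show "S \<inter> U \<subseteq> ?q ` topspace X" "openin X {x \<in> topspace X. ?q x \<in> S \<inter> U}"
      by auto
  next
    fix \<K>
    assume *: "\<forall>K\<in>\<K>. K \<subseteq> ?q ` topspace X \<and> openin X {x \<in> topspace X. ?q x \<in> K}"
    then show "\<Union>\<K> \<subseteq> ?q ` topspace X" by auto
    have "{x \<in> topspace X. ?q x \<in> \<Union>\<K>} = (\<Union>K\<in>\<K>. {x \<in> topspace X. ?q x \<in> K})"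
      by auto
    then show "openin X {x \<in> topspace X. ?q x \<in> \<Union>\<K>}"
      using * by auto
  qed
  then show ?thesis
    by (simp add: orbit_space_def topology_inverse')
qed

lemma topspace_orbit_space: "topspace (orbit_space G X act) = bi_orbit G X act ` topspace X"
proof
  have "{x \<in> topspace X. bi_orbit G X act x \<in> bi_orbit G X act ` topspace X} = topspace X"
    by auto
  then show "bi_orbit G X act ` topspace X \<subseteq> topspace (orbit_space G X act)"
    by (intro openin_subset) (simp add: openin_orbit_space)
qed (use openin_orbit_space[of G X act "topspace (orbit_space G X act)"] in simp)

lemma quotient_map_bi_orbit: "quotient_map X (orbit_space G X act) (bi_orbit G X act)"
  by (auto simp: quotient_map_def topspace_orbit_space openin_orbit_space)

end

(* For G compact the orbit map q is proper. Distributivity gives g(g'(x,x), g'(x,x)) = g'g(x,x), so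
   y lies in the orbit of a point of C iff g(y,y) lies in C for some g. Hence the saturation of C is
   the projection along G of the preimage of C under (g,y) |-> g(y,y); it is open if C is open, and
   closed if C is closed and G is compact. The fibres of q are continuous images of G. Compactness
   and local compactness pass both ways along a continuous open proper surjection. *)
theory Submission
  imports Defs
begin

text \<open>Compactness goes down because \<open>Y\<close> is the image of \<open>X\<close>, and up
  because \<open>X\<close> is the full preimage of \<open>Y\<close> and proper maps pull compact
  sets back to compact sets.\<close>

lemma compact_space_proper_map_iff:
  assumes "proper_map X Y f" "continuous_map X Y f" "f ` topspace X = topspace Y"
  shows "compact_space Y \<longleftrightarrow> compact_space X"
proof
  assume "compact_space X"
  then show "compact_space Y"
    using assms image_compactin by (metis compact_space_def)
next
  assume "compact_space Y"
  then have "compactin X {x \<in> topspace X. f x \<in> topspace Y}"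
    using assms(1) by (simp add: compactin_proper_map_preimage compact_space_def)
  moreover have "{x \<in> topspace X. f x \<in> topspace Y} = topspace X"
    using assms(3) by auto
  ultimately show "compact_space X"
    by (simp add: compact_space_def)
qed

lemma locally_compact_closure_space_proper_map_iff:
  assumes proper: "proper_map X Y f" and cont: "continuous_map X Y f" and "open_map X Y f"
    and surj: "f ` topspace X = topspace Y"
  shows "locally_compact_closure_space Y \<longleftrightarrow> locally_compact_closure_space X"
proof
  assume Y: "locally_compact_closure_space Y"
  show "locally_compact_closure_space X"
    unfolding locally_compact_closure_space_def
  proof
    fix x assume x: "x \<in> topspace X"
    then obtain V where V: "openin Y V" "f x \<in> V" "compactin Y (Y closure_of V)"
      using Y surj unfolding locally_compact_closure_space_def by blast
    let ?U = "{z \<in> topspace X. f z \<in> V}" and ?K = "{z \<in> topspace X. f z \<in> Y closure_of V}"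
    have "compactin X ?K"
      using compactin_proper_map_preimage[OF proper V(3)] .
    \<comment> \<open>By continuity \<open>?K\<close> is closed, so the closure of \<open>?U\<close>
      is a closed subset of a compact set.\<close>
    moreover have "X closure_of ?U \<subseteq> ?K"
    proof (rule closure_of_minimal)
      show "?U \<subseteq> ?K"
        using closure_of_subset[OF openin_subset[OF V(1)]] by auto
      show "closedin X ?K"
        using closedin_continuous_map_preimage[OF cont closedin_closure_of] .
    qed
    ultimately have "compactin X (X closure_of ?U)"
      using closed_compactin closedin_closure_of by blast
    moreover have "openin X ?U"
      using openin_continuous_map_preimage[OF cont V(1)] .
    ultimately show "\<exists>U. openin X U \<and> x \<in> U \<and> compactin X (X closure_of U)"
      using x V(2) by blast
  qed
next
  assume X: "locally_compact_closure_space X"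
  show "locally_compact_closure_space Y"
    unfolding locally_compact_closure_space_def
  proof
    fix y assume "y \<in> topspace Y"
    then obtain x where x: "x \<in> topspace X" "y = f x"
      using surj by blast
    then obtain U where U: "openin X U" "x \<in> U" "compactin X (X closure_of U)"
      using X unfolding locally_compact_closure_space_def by blast
    have "Y closure_of (f ` U) \<subseteq> f ` (X closure_of U)"
    proof (rule closure_of_minimal)
      show "f ` U \<subseteq> f ` (X closure_of U)"
        using closure_of_subset[OF openin_subset[OF U(1)]] by auto
      show "closedin Y (f ` (X closure_of U))"
        using proper unfolding proper_map_def closed_map_def by simp
    qed
    then have "compactin Y (Y closure_of (f ` U))"
      using closed_compactin closedin_closure_of image_compactin[OF U(3) cont] by blast
    moreover have "openin Y (f ` U)"
      using \<open>open_map X Y f\<close> U(1) unfolding open_map_def by blast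
    ultimately show "\<exists>V. openin Y V \<and> y \<in> V \<and> compactin Y (Y closure_of V)"
      using x U(2) by blast
  qed
qed

context binary_G_space
begin

text \<open>Orbits are produced by the diagonal alone. Its joint continuity serves the closedness of
  the orbit map; the sections with \<open>g\<close> or \<open>x\<close> fixed serve openness and the
  compactness of fibres.\<close>

lemma continuous_map_diagonal_act:
  "continuous_map (prod_topology T X) X (\<lambda>(g, x). act g x x)"
proof -
  have "continuous_map (prod_topology T X) (prod_topology T (prod_topology X X))
      (\<lambda>p. (fst p, (snd p, snd p)))"
    by (simp add: continuous_map_pairedI continuous_map_fst continuous_map_snd)
  from continuous_map_compose[OF this continuous_act] show ?thesis
    by (simp add: o_def case_prod_unfold)
qed

lemma continuous_map_diagonal_act_section:
  assumes "g \<in> carrier G"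
  shows "continuous_map X X (\<lambda>x. act g x x)"
proof -
  have "continuous_map X (prod_topology T X) (\<lambda>x. (g, x))"
    using assms by (simp add: continuous_map_pairedI topspace_eq_carrier)
  from continuous_map_compose[OF this continuous_map_diagonal_act] show ?thesis
    by (simp add: o_def)
qed

lemma continuous_map_orbit_section:
  assumes "x \<in> topspace X"
  shows "continuous_map T X (\<lambda>g. act g x x)"
proof -
  have "continuous_map T (prod_topology T X) (\<lambda>g. (g, x))"
    using assms by (simp add: continuous_map_pairedI)
  from continuous_map_compose[OF this continuous_map_diagonal_act] show ?thesis
    by (simp add: o_def)
qed

end

context distributive_binary_G_space
begin

text \<open>Once both arguments carry the common factor \<open>act h x\<close>, distributivity pulls
  it out; what remains has first argument \<open>x\<close> throughout, so \<open>act_mult\<close>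
  collects it into one group element. For \<open>k = h\<close> the result is
  \<open>h \<otimes> g\<close>: the diagonal is a right action.\<close>

lemma act_orbit_points:
  assumes g: "g \<in> carrier G" and h: "h \<in> carrier G" and k: "k \<in> carrier G"
    and x: "x \<in> topspace X"
  shows "act g (act h x x) (act k x x) = act (h \<otimes> g \<otimes> inv h \<otimes> k) x x"
proof -
  have hk: "act k x x = act h x (act (inv h \<otimes> k) x x)"
    using h k x by (simp add: act_mult[symmetric] m_assoc[symmetric])
  have "act g (act h x x) (act k x x) = act h x (act g x (act (inv h \<otimes> k) x x))"
    unfolding hk using g h k x by (simp add: distributive act_closed)
  also have "\<dots> = act (h \<otimes> (g \<otimes> (inv h \<otimes> k))) x x"
    using g h k x by (simp add: act_mult)
  finally show ?thesis
    using g h k by (simp add: m_assoc)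
qed

text \<open>By \<open>act_orbit_points\<close> the right-hand side is closed under the action, and
  it contains \<open>x\<close> through the identity, so minimality gives one inclusion. The other is
  bi-invariance of the hull.\<close>

lemma bi_orbit_eq:
  assumes x: "x \<in> topspace X"
  shows "bi_orbit G X act x = (\<lambda>g. act g x x) ` carrier G" (is "_ = ?O")
proof
  have "act g a b \<in> ?O" if "g \<in> carrier G" "a \<in> ?O" "b \<in> ?O" for g a b
    using that x by (auto simp: act_orbit_points)
  then have "bi_invariant G X act ?O"
    using x by (auto simp: bi_invariant_iff_closed act_closed)
  moreover have "x \<in> ?O"
    using act_one[OF x x] one_closed by (metis imageI)
  ultimately show "bi_orbit G X act x \<subseteq> ?O"
    by (rule bi_orbit_minimal)
  show "?O \<subseteq> bi_orbit G X act x"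
    using bi_invariant_bi_orbit[OF x] bi_orbit_refl[of x] by (auto simp: bi_invariant_iff_closed)
qed

lemma bi_orbit_eq_iff:
  assumes x: "x \<in> topspace X" and y: "y \<in> topspace X"
  shows "bi_orbit G X act x = bi_orbit G X act y \<longleftrightarrow> (\<exists>g \<in> carrier G. act g x x = y)"
proof
  assume "bi_orbit G X act x = bi_orbit G X act y"
  then show "\<exists>g \<in> carrier G. act g x x = y"
    using bi_orbit_refl[of y] bi_orbit_eq[OF x] by (metis imageE)
next
  assume "\<exists>g \<in> carrier G. act g x x = y"
  then obtain g where g: "g \<in> carrier G" "y = act g x x"
    by blast
  \<comment> \<open>\<open>act_orbit_points\<close> with both points equal to \<open>y\<close>
    yields the group element \<open>g \<otimes> inv g \<otimes> inv g \<otimes> g\<close>, which is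
    the identity.\<close>
  have "act (inv g) y y = x"
    using g x by (simp add: act_orbit_points act_one)
  then have "x \<in> bi_orbit G X act y"
    using g(1) bi_orbit_eq[OF y] by (metis imageI inv_closed)
  moreover have "y \<in> bi_orbit G X act x"
    using g bi_orbit_eq[OF x] by blast
  ultimately show "bi_orbit G X act x = bi_orbit G X act y"
    using bi_orbit_minimal bi_invariant_bi_orbit x y by (metis subset_antisym)
qed

text \<open>Moving \<open>y\<close> into \<open>C\<close>, rather than points of \<open>C\<close> to
  \<open>y\<close>, exhibits the saturation through preimages of \<open>C\<close> under continuous
  maps.\<close>

lemma saturation_eq:
  assumes "C \<subseteq> topspace X"
  shows "{y \<in> topspace X. bi_orbit G X act y \<in> bi_orbit G X act ` C}
    = {y \<in> topspace X. \<exists>g \<in> carrier G. act g y y \<in> C}"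
proof -
  have "bi_orbit G X act y \<in> bi_orbit G X act ` C \<longleftrightarrow> (\<exists>g \<in> carrier G. act g y y \<in> C)"
    if y: "y \<in> topspace X" for y
  proof -
    have "bi_orbit G X act y \<in> bi_orbit G X act ` C
        \<longleftrightarrow> (\<exists>c \<in> C. \<exists>g \<in> carrier G. act g y y = c)"
      using assms bi_orbit_eq_iff[OF y] by (auto simp: image_iff subset_iff)
    then show ?thesis
      by blast
  qed
  then show ?thesis
    by blast
qed

lemma open_map_bi_orbit: "open_map X (orbit_space G X act) (bi_orbit G X act)"
  unfolding open_map_def
proof (intro allI impI)
  fix U assume U: "openin X U"
  then have "U \<subseteq> topspace X"
    by (rule openin_subset)
  \<comment> \<open>Arbitrary unions of open sets are open, so each \<open>g\<close> can be treated
    separately.\<close>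
  moreover have "{y \<in> topspace X. \<exists>g \<in> carrier G. act g y y \<in> U}
      = (\<Union>g \<in> carrier G. {y \<in> topspace X. act g y y \<in> U})"
    by blast
  moreover have "openin X {y \<in> topspace X. act g y y \<in> U}" if "g \<in> carrier G" for g
    using openin_continuous_map_preimage[OF continuous_map_diagonal_act_section[OF that] U] .
  ultimately show "openin (orbit_space G X act) (bi_orbit G X act ` U)"
    by (auto simp: openin_orbit_space saturation_eq)
qed

lemma proper_map_bi_orbit:
  assumes "compact_space T"
  shows "proper_map X (orbit_space G X act) (bi_orbit G X act)"
  unfolding proper_map_def closed_map_def
proof (intro conjI allI impI ballI)
  fix C assume C: "closedin X C"
  then have sub: "C \<subseteq> topspace X"
    by (rule closedin_subset)
  let ?P = "{p \<in> topspace (prod_topology T X). (\<lambda>(g, y). act g y y) p \<in> C}"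
  \<comment> \<open>An infinite union of closed sets need not be closed; compactness of
    \<open>T\<close> replaces that argument, since projection along a compact factor is a closed
    map.\<close>
  have "closedin X (snd ` ?P)"
    using closedin_continuous_map_preimage[OF continuous_map_diagonal_act C] closed_map_snd assms
    unfolding closed_map_def by blast
  moreover have "snd ` ?P = {y \<in> topspace X. \<exists>g \<in> carrier G. act g y y \<in> C}"
    by (force simp: topspace_eq_carrier)
  ultimately have "closedin X {y \<in> topspace X. bi_orbit G X act y \<in> bi_orbit G X act ` C}"
    by (simp add: saturation_eq[OF sub])
  then show "closedin (orbit_space G X act) (bi_orbit G X act ` C)"
    using quotient_map_bi_orbit[of X G act] sub
    by (simp add: quotient_map_closedin topspace_orbit_space image_mono)
next
  fix y assume "y \<in> topspace (orbit_space G X act)"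
  then obtain x where x: "x \<in> topspace X" "y = bi_orbit G X act x"
    by (auto simp: topspace_orbit_space)
  \<comment> \<open>Here the fixed point \<open>x\<close> is moved to \<open>z\<close>, the opposite
    direction to \<open>saturation_eq\<close>, so that the fibre becomes a continuous image of the
    compact group.\<close>
  have "bi_orbit G X act z = y \<longleftrightarrow> (\<exists>g \<in> carrier G. act g x x = z)" if "z \<in> topspace X" for z
    using bi_orbit_eq_iff[OF x(1) that] x(2) by auto
  then have "{z \<in> topspace X. bi_orbit G X act z = y} = (\<lambda>g. act g x x) ` topspace T"
    using act_closed[OF _ x(1) x(1)] unfolding topspace_eq_carrier by blast
  moreover have "compactin X ((\<lambda>g. act g x x) ` topspace T)"
    using image_compactin[OF _ continuous_map_orbit_section[OF x(1)]] assms
    by (simp add: compact_space_def)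
  ultimately show "compactin X {z \<in> topspace X. bi_orbit G X act z = y}"
    by simp
qed

end

theorem theorem6:
  fixes G :: "('g, 'm) monoid_scheme" and T :: "'g topology"
    and X :: "'x topology" and act :: "'g \<Rightarrow> 'x \<Rightarrow> 'x \<Rightarrow> 'x"
  assumes "topological_group G T" and "compact_space T" and "Hausdorff_space T"
    and "distributive_binary_G_space G T X act" and "Hausdorff_space X"
  shows "(compact_space (orbit_space G X act) \<longleftrightarrow> compact_space X) \<and>
    (locally_compact_closure_space (orbit_space G X act) \<longleftrightarrow> locally_compact_closure_space X)"
proof -
  interpret distributive_binary_G_space G T X act by fact
  note proper = proper_map_bi_orbit[OF assms(2)]
    and cont = quotient_imp_continuous_map[OF quotient_map_bi_orbit]
    and surj = topspace_orbit_space[symmetric]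
  show ?thesis
    using compact_space_proper_map_iff[OF proper cont surj]
      locally_compact_closure_space_proper_map_iff[OF proper cont open_map_bi_orbit surj] ..
qed

end
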